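(* For every $\Delta^0_2$ function $f : \omega\to\omega$, there is a $\Delta^0_2$ increasing function $g : \omega\to\omega$ such that $f$ does not dominate $p_H$ for any infinite $g$-transitive set $H$.
   Context: Given $g$, an interval $[a,b]$ is $g$-large if $b \geq g(a)$ and $g$-small otherwise; a set $H$ is $g$-transitive if for every $x<y<z$ in $H$ with $[x,y]$ and $[y,z]$ $g$-small, $[x,z]$ is $g$-small. The principal function of an infinite set $H = \{x_0<x_1<\dots\}$ is $p_H(n) = x_n$. $f$ dominates $p_H$ if $f(x) \geq p_H(x)$ for every $x$. *)

theory Defs
  imports Main "HOL-Library.Infinite_Set"
begin

text \<open>
  A \<open>k\<close>-ary function (relation) on the natural numbers is represented by a function (predicate) on
  lists, of which only the values at lists of length \<open>k\<close> are meaningful.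

  The total recursive functions form the least class containing zero, successor and the projections
  and closed under composition, primitive recursion and minimization of regular functions. In the
  last two schemes the recursion (search) variable is the first argument.
\<close>

inductive recursive_fn :: "nat \<Rightarrow> (nat list \<Rightarrow> nat) \<Rightarrow> bool" where
  zero: "recursive_fn k (\<lambda>xs. 0)"
| succ: "recursive_fn 1 (\<lambda>xs. Suc (xs ! 0))"
| proj: "i < k \<Longrightarrow> recursive_fn k (\<lambda>xs. xs ! i)"
| comp: "recursive_fn (length gs) f \<Longrightarrow> \<forall>g\<in>set gs. recursive_fn k g \<Longrightarrow>
    recursive_fn k (\<lambda>xs. f (map (\<lambda>g. g xs) gs))"
| prim_rec: "recursive_fn k f \<Longrightarrow> recursive_fn (Suc (Suc k)) g \<Longrightarrow>
    recursive_fn (Suc k)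
      (\<lambda>xs. rec_nat (f (tl xs)) (\<lambda>n r. g (n # r # tl xs)) (hd xs))"
| minim: "recursive_fn (Suc k) f \<Longrightarrow> \<forall>xs. length xs = k \<longrightarrow> (\<exists>y. f (y # xs) = 0) \<Longrightarrow>
    recursive_fn k (\<lambda>xs. LEAST y. f (y # xs) = 0)"

definition recursive_rel :: "nat \<Rightarrow> (nat list \<Rightarrow> bool) \<Rightarrow> bool" where
  "recursive_rel k R \<longleftrightarrow>
    (\<exists>c. recursive_fn k c \<and> (\<forall>xs. length xs = k \<longrightarrow> c xs = (if R xs then 1 else 0)))"

text \<open>
  The (lightface) arithmetical hierarchy of \<open>k\<close>-ary relations: a relation is \<open>\<Sigma>\<close> at level \<open>n + 1\<close>
  if it has the form \<open>\<exists>y. Q (y, xs)\<close> with \<open>Q\<close> the complement of a relation that is \<open>\<Sigma>\<close>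
  at level \<open>n\<close>, that is, with \<open>Q\<close> being \<open>\<Pi>\<close> at level \<open>n\<close>.
\<close>

fun Sigma0 :: "nat \<Rightarrow> nat \<Rightarrow> (nat list \<Rightarrow> bool) \<Rightarrow> bool" where
  "Sigma0 0 k A \<longleftrightarrow> recursive_rel k A"
| "Sigma0 (Suc n) k A \<longleftrightarrow>
    (\<exists>B. Sigma0 n (Suc k) B \<and> (\<forall>xs. length xs = k \<longrightarrow> (A xs \<longleftrightarrow> (\<exists>y. \<not> B (y # xs)))))"

definition Pi0 :: "nat \<Rightarrow> nat \<Rightarrow> (nat list \<Rightarrow> bool) \<Rightarrow> bool" where
  "Pi0 n k A \<longleftrightarrow> Sigma0 n k (\<lambda>xs. \<not> A xs)"

definition Delta0 :: "nat \<Rightarrow> nat \<Rightarrow> (nat list \<Rightarrow> bool) \<Rightarrow> bool" where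
  "Delta0 n k A \<longleftrightarrow> Sigma0 n k A \<and> Pi0 n k A"

definition Delta0_fn :: "nat \<Rightarrow> (nat \<Rightarrow> nat) \<Rightarrow> bool" where
  "Delta0_fn n f \<longleftrightarrow> Delta0 n 2 (\<lambda>xs. f (xs ! 0) = xs ! 1)"

text \<open>An interval \<open>[a, b]\<close> is given by its endpoints.\<close>

definition g_large :: "(nat \<Rightarrow> nat) \<Rightarrow> nat \<Rightarrow> nat \<Rightarrow> bool" where
  "g_large g a b \<longleftrightarrow> b \<ge> g a"

definition g_small :: "(nat \<Rightarrow> nat) \<Rightarrow> nat \<Rightarrow> nat \<Rightarrow> bool" where
  "g_small g a b \<longleftrightarrow> \<not> g_large g a b"

definition g_transitive :: "(nat \<Rightarrow> nat) \<Rightarrow> nat set \<Rightarrow> bool" where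
  "g_transitive g H \<longleftrightarrow>
    (\<forall>x\<in>H. \<forall>y\<in>H. \<forall>z\<in>H. x < y \<longrightarrow> y < z \<longrightarrow>
      g_small g x y \<longrightarrow> g_small g y z \<longrightarrow> g_small g x z)"

definition principal_fn :: "nat set \<Rightarrow> nat \<Rightarrow> nat" where
  "principal_fn H n = enumerate H n"

definition dominates :: "(nat \<Rightarrow> nat) \<Rightarrow> (nat \<Rightarrow> nat) \<Rightarrow> bool" where
  "dominates f p \<longleftrightarrow> (\<forall>x. f x \<ge> p x)"

end

theory Submission
  imports Defs
begin

text \<open>
  If \<open>H\<close> is infinite and \<open>g\<close>-transitive and \<open>x \<in> H\<close>, let \<open>y\<close> be the last element of \<open>H\<close> that is equal
  to \<open>x\<close> or lies below \<open>g x\<close>, and let \<open>z\<close> be its successor in \<open>H\<close>. Then \<open>[x, z]\<close> is large, so by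
  transitivity \<open>[y, z]\<close> is large. Writing \<open>y = p\<^sub>H n\<close>, we have \<open>n \<le> y\<close>, so that \<open>f\<close> fails to bound
  \<open>p\<^sub>H (n + 1) = z \<ge> g y\<close> as soon as \<open>g y\<close> exceeds \<open>f i\<close> for all \<open>i \<le> y + 1\<close>.

  To obtain such a \<open>g\<close> without coding sequences, write \<open>f i = w \<longleftrightarrow> (\<exists>y. \<forall>z. C z y i w)\<close> with \<open>C\<close>
  recursive, and let \<open>g x\<close> be the least \<open>v\<close> such that for all \<open>i \<le> x + 1\<close> there are \<open>w, y < v - x\<close>
  with \<open>\<forall>z. C z y i w\<close>. By the pigeonhole principle the unbounded quantifier moves to the front, so
  this condition on \<open>v\<close> is \<open>\<Pi>\<^sub>1\<close>; it is also monotone in \<open>v\<close>, hence \<open>g x = v\<close> is the conjunction of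
  the condition for \<open>v\<close> and its negation for \<open>v - 1\<close>.
\<close>

section \<open>Closure properties of recursive functions and relations\<close>

text \<open>Unlike \<^const>\<open>recursive_fn\<close>, this notion ignores the values at lists of length other than \<open>k\<close>.\<close>

definition recursive_on :: "nat \<Rightarrow> (nat list \<Rightarrow> nat) \<Rightarrow> bool" where
  "recursive_on k f \<longleftrightarrow> (\<exists>c. recursive_fn k c \<and> (\<forall>xs. length xs = k \<longrightarrow> c xs = f xs))"

lemma recursive_rel_iff:
  "recursive_rel k R \<longleftrightarrow> recursive_on k (\<lambda>xs. if R xs then 1 else 0)"
  by (simp add: recursive_rel_def recursive_on_def)

lemma recursive_on_cong:
  "recursive_on k f \<Longrightarrow> (\<And>xs. length xs = k \<Longrightarrow> f xs = g xs) \<Longrightarrow> recursive_on k g"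
  unfolding recursive_on_def by metis

lemma recursive_rel_cong:
  "recursive_rel k R \<Longrightarrow> (\<And>xs. length xs = k \<Longrightarrow> R xs \<longleftrightarrow> S xs) \<Longrightarrow> recursive_rel k S"
  unfolding recursive_rel_iff by (erule recursive_on_cong) simp

lemma recursive_on_zero: "recursive_on k (\<lambda>xs. 0)"
  unfolding recursive_on_def using recursive_fn.zero by blast

lemma recursive_on_nth: "i < k \<Longrightarrow> recursive_on k (\<lambda>xs. xs ! i)"
  unfolding recursive_on_def using recursive_fn.proj by blast

lemma recursive_on_comp:
  assumes "recursive_on (length gs) f" "\<And>g. g \<in> set gs \<Longrightarrow> recursive_on k g"
  shows "recursive_on k (\<lambda>xs. f (map (\<lambda>g. g xs) gs))"
proof -
  obtain c where c: "recursive_fn (length gs) c" "\<And>xs. length xs = length gs \<Longrightarrow> c xs = f xs"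
    using assms(1) unfolding recursive_on_def by blast
  obtain D where D: "\<And>g. g \<in> set gs \<Longrightarrow> recursive_fn k (D g)"
    "\<And>g xs. g \<in> set gs \<Longrightarrow> length xs = k \<Longrightarrow> D g xs = g xs"
    using assms(2) unfolding recursive_on_def by metis
  have "recursive_fn k (\<lambda>xs. c (map (\<lambda>g. g xs) (map D gs)))"
    by (rule recursive_fn.comp) (use c D in auto)
  moreover have "c (map (\<lambda>g. g xs) (map D gs)) = f (map (\<lambda>g. g xs) gs)" if "length xs = k" for xs
    using c(2)[of "map (\<lambda>g. g xs) gs"] D(2)[OF _ that] by (simp add: comp_def cong: map_cong)
  ultimately show ?thesis
    unfolding recursive_on_def by blast
qed

lemma recursive_rel_comp:
  assumes "recursive_rel (length gs) R" "\<And>g. g \<in> set gs \<Longrightarrow> recursive_on k g"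
  shows "recursive_rel k (\<lambda>xs. R (map (\<lambda>g. g xs) gs))"
  using recursive_on_comp[OF assms(1)[unfolded recursive_rel_iff] assms(2)]
  unfolding recursive_rel_iff .

lemma recursive_on_Suc:
  assumes "recursive_on k f"
  shows "recursive_on k (\<lambda>xs. Suc (f xs))"
proof -
  have "recursive_on (length [f]) (\<lambda>xs. Suc (xs ! 0))"
    unfolding recursive_on_def using recursive_fn.succ by auto
  from recursive_on_comp[OF this, of k] show ?thesis
    using assms by simp
qed

text \<open>This keeps one chosen variable and removes the leading \<open>n\<close> ones. It serves
  to ignore the accumulator of a recursion, or one of two quantified variables.\<close>

lemma recursive_rel_nth_Cons_drop:
  assumes "recursive_rel (Suc k) R" "j < n + k"
  shows "recursive_rel (n + k) (\<lambda>xs. R (xs ! j # drop n xs))"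
proof -
  let ?gs = "(\<lambda>xs. xs ! j) # map (\<lambda>i xs. xs ! (n + i)) [0..<k]"
  have "recursive_rel (n + k) (\<lambda>xs. R (map (\<lambda>g. g xs) ?gs))"
    by (rule recursive_rel_comp) (use assms recursive_on_nth in auto)
  then show ?thesis
  proof (rule recursive_rel_cong)
    fix xs :: "nat list" assume "length xs = n + k"
    then have "map (\<lambda>g. g xs) ?gs = xs ! j # drop n xs"
      by (auto intro!: nth_equalityI)
    then show "R (map (\<lambda>g. g xs) ?gs) \<longleftrightarrow> R (xs ! j # drop n xs)"
      by simp
  qed
qed

text \<open>The scheme \<open>prim_rec\<close> recurses on the first argument only. Composing it
  with \<open>N\<close> and all projections lets the recursion run up to \<open>N xs\<close> with
  \<open>xs\<close> as parameters.\<close>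

lemma recursive_on_rec_nat:
  assumes N: "recursive_on k N" and f: "recursive_on k f" and g: "recursive_on (Suc (Suc k)) g"
  shows "recursive_on k (\<lambda>xs. rec_nat (f xs) (\<lambda>n r. g (n # r # xs)) (N xs))"
proof -
  obtain c where c: "recursive_fn k c" "\<And>xs. length xs = k \<Longrightarrow> c xs = f xs"
    using f unfolding recursive_on_def by blast
  obtain d where d: "recursive_fn (Suc (Suc k)) d"
    "\<And>xs. length xs = Suc (Suc k) \<Longrightarrow> d xs = g xs"
    using g unfolding recursive_on_def by blast
  let ?h = "\<lambda>xs. rec_nat (c (tl xs)) (\<lambda>n r. d (n # r # tl xs)) (hd xs)"
  let ?gs = "N # map (\<lambda>i xs. xs ! i) [0..<k]"
  have "recursive_on (length ?gs) ?h"
    using recursive_fn.prim_rec[OF c(1) d(1)] unfolding recursive_on_def by auto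
  then have "recursive_on k (\<lambda>xs. ?h (map (\<lambda>g. g xs) ?gs))"
    by (rule recursive_on_comp) (use N recursive_on_nth in auto)
  then show ?thesis
  proof (rule recursive_on_cong)
    fix xs :: "nat list" assume len: "length xs = k"
    have "map (\<lambda>g. g xs) ?gs = N xs # xs"
      using len by (auto intro!: nth_equalityI)
    then show "?h (map (\<lambda>g. g xs) ?gs) = rec_nat (f xs) (\<lambda>n r. g (n # r # xs)) (N xs)"
      using c(2)[OF len] d(2) len by simp
  qed
qed

section \<open>Truncated subtraction, Boolean operations and bounded quantifiers\<close>

lemma recursive_on_pred:
  assumes "recursive_on k f"
  shows "recursive_on k (\<lambda>xs. f xs - 1)"
proof -
  have "recursive_on k (\<lambda>xs. rec_nat 0 (\<lambda>n r. (n # r # xs) ! 0) (f xs))"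
    by (rule recursive_on_rec_nat) (use assms recursive_on_zero recursive_on_nth in auto)
  then show ?thesis
  proof (rule recursive_on_cong)
    show "rec_nat 0 (\<lambda>n r. (n # r # xs) ! 0) (f xs) = f xs - 1" for xs
      by (cases "f xs") auto
  qed
qed

lemma recursive_on_diff:
  assumes "recursive_on k f" "recursive_on k g"
  shows "recursive_on k (\<lambda>xs. f xs - g xs)"
proof -
  have "recursive_on k (\<lambda>xs. rec_nat (f xs) (\<lambda>n r. (n # r # xs) ! 1 - 1) (g xs))"
    by (rule recursive_on_rec_nat)
      (use assms recursive_on_pred[OF recursive_on_nth[of 1 "Suc (Suc k)"]] in auto)
  moreover have "rec_nat a (\<lambda>n r. r - 1) m = a - m" for a m :: nat
    by (induction m) auto
  ultimately show ?thesis
    by simp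
qed

lemma recursive_rel_not:
  assumes "recursive_rel k R"
  shows "recursive_rel k (\<lambda>xs. \<not> R xs)"
proof -
  have "recursive_on k (\<lambda>xs. Suc 0 - (if R xs then 1 else 0))"
    using assms unfolding recursive_rel_iff
    by (intro recursive_on_diff recursive_on_Suc recursive_on_zero)
  then show ?thesis
    unfolding recursive_rel_iff by (rule recursive_on_cong) simp
qed

lemma recursive_rel_conj:
  assumes "recursive_rel k R" "recursive_rel k S"
  shows "recursive_rel k (\<lambda>xs. R xs \<and> S xs)"
proof -
  \<comment> \<open>On truth values \<open>r\<close> and \<open>s\<close>, the truncated difference
    \<open>r - (1 - s)\<close> is their conjunction.\<close>
  have "recursive_on k (\<lambda>xs. (if R xs then 1 else 0) - (Suc 0 - (if S xs then 1 else 0)))"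
    using assms unfolding recursive_rel_iff
    by (intro recursive_on_diff recursive_on_Suc recursive_on_zero)
  then show ?thesis
    unfolding recursive_rel_iff by (rule recursive_on_cong) simp
qed

lemma recursive_rel_ball_less:
  assumes N: "recursive_on k N" and R: "recursive_rel (Suc k) R"
  shows "recursive_rel k (\<lambda>xs. \<forall>i<N xs. R (i # xs))"
proof -
  let ?R = "\<lambda>xs. if R xs then 1 else 0 :: nat"
  have "recursive_on (Suc (Suc k)) (\<lambda>ys. ?R (ys ! 0 # drop 2 ys))"
    using recursive_rel_nth_Cons_drop[OF R, of 0 2] by (simp add: recursive_rel_iff)
  \<comment> \<open>The accumulator \<open>ys ! 1\<close> is the truth value of the conjunction so
    far; it starts at 1.\<close>
  then have "recursive_on (Suc (Suc k)) (\<lambda>ys. ys ! 1 - (Suc 0 - ?R (ys ! 0 # drop 2 ys)))"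
    by (intro recursive_on_diff recursive_on_nth recursive_on_Suc recursive_on_zero) simp_all
  from recursive_on_rec_nat[OF N recursive_on_Suc[OF recursive_on_zero] this]
  have "recursive_on k (\<lambda>xs. rec_nat (Suc 0) (\<lambda>n r. r - (Suc 0 - ?R (n # xs))) (N xs))"
    by (simp del: One_nat_def split del: if_split)
  moreover have "rec_nat (Suc 0) (\<lambda>n r. r - (Suc 0 - ?R (n # xs))) m
      = (if \<forall>i<m. R (i # xs) then 1 else 0)" for xs m
    by (induction m) (auto simp: less_Suc_eq)
  ultimately show ?thesis
    by (simp add: recursive_rel_iff)
qed

lemma recursive_rel_bex_less:
  assumes "recursive_on k N" "recursive_rel (Suc k) R"
  shows "recursive_rel k (\<lambda>xs. \<exists>i<N xs. R (i # xs))"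
  using recursive_rel_not[OF recursive_rel_ball_less[OF assms(1) recursive_rel_not[OF assms(2)]]]
  by simp

section \<open>The second level of the arithmetical hierarchy\<close>

lemma Sigma0_2_iff:
  "Sigma0 2 k A \<longleftrightarrow> (\<exists>C. recursive_rel (Suc (Suc k)) C \<and>
    (\<forall>xs. length xs = k \<longrightarrow> (A xs \<longleftrightarrow> (\<exists>y. \<forall>z. C (z # y # xs)))))"
  (is "_ \<longleftrightarrow> ?rhs")
proof
  assume "Sigma0 2 k A"
  then show ?rhs
    by (fastforce simp: numeral_2_eq_2)
next
  assume ?rhs
  then obtain C where C: "recursive_rel (Suc (Suc k)) C"
    "\<forall>xs. length xs = k \<longrightarrow> (A xs \<longleftrightarrow> (\<exists>y. \<forall>z. C (z # y # xs)))"
    by blast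
  have "Sigma0 1 (Suc k) (\<lambda>ys. \<exists>z. \<not> C (z # ys))"
    using C(1) by auto
  moreover have "\<forall>xs. length xs = k \<longrightarrow> (A xs \<longleftrightarrow> (\<exists>y. \<not> (\<exists>z. \<not> C (z # y # xs))))"
    using C(2) by simp
  ultimately show "Sigma0 2 k A"
    unfolding numeral_2_eq_2 Sigma0.simps(2)[of "Suc 0"] One_nat_def by blast
qed

text \<open>In a conjunction of a \<open>\<Pi>\<close> and a \<open>\<Sigma>\<close> statement of
  level 1, the quantifiers are independent, so either may come first.
  \<open>\<exists>\<forall>\<close> suits the relation, \<open>\<forall>\<exists>\<close> its
  negation.\<close>

lemma Delta0_2I:
  assumes R: "recursive_rel (Suc k) R" and S: "recursive_rel (Suc k) S"
    and A: "\<And>xs. length xs = k \<Longrightarrow> A xs \<longleftrightarrow> (\<forall>z. R (z # xs)) \<and> (\<exists>z. S (z # xs))"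
  shows "Delta0 2 k A"
proof -
  let ?outer = "\<lambda>T ys. T (ys ! 1 # drop 2 ys)" and ?inner = "\<lambda>T ys. T (ys ! 0 # drop 2 ys)"
  have subst: "recursive_rel (Suc (Suc k)) (\<lambda>ys. T (ys ! j # drop 2 ys))"
    if "recursive_rel (Suc k) T" "j < 2" for T j
    using recursive_rel_nth_Cons_drop[of k T j 2] that by simp
  have "recursive_rel (Suc (Suc k)) (\<lambda>ys. ?inner R ys \<and> ?outer S ys)"
    using subst R S by (intro recursive_rel_conj) auto
  moreover have "recursive_rel (Suc (Suc k)) (\<lambda>ys. \<not> (?outer R ys \<and> ?inner S ys))"
    using subst R S by (intro recursive_rel_not recursive_rel_conj) auto
  moreover have "A xs \<longleftrightarrow> (\<exists>y. \<forall>z. ?inner R (z # y # xs) \<and> ?outer S (z # y # xs))"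
    "\<not> A xs \<longleftrightarrow> (\<exists>y. \<forall>z. \<not> (?outer R (z # y # xs) \<and> ?inner S (z # y # xs)))"
    if "length xs = k" for xs
    using A[OF that] by auto
  ultimately show ?thesis
    unfolding Delta0_def Pi0_def Sigma0_2_iff by blast
qed

text \<open>If each of the finitely many \<open>p\<close> failed at some \<open>h p\<close>, a bound
  \<open>Z\<close> above all these values would leave no \<open>p\<close>.\<close>

lemma bex_all_iff_all_bex_less:
  fixes D :: "'a \<Rightarrow> nat \<Rightarrow> bool"
  assumes "finite A"
  shows "(\<exists>p\<in>A. \<forall>z. D p z) \<longleftrightarrow> (\<forall>Z. \<exists>p\<in>A. \<forall>z<Z. D p z)"
proof
  assume R: "\<forall>Z. \<exists>p\<in>A. \<forall>z<Z. D p z"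
  show "\<exists>p\<in>A. \<forall>z. D p z"
  proof (rule ccontr)
    assume "\<not> ?thesis"
    then obtain h where h: "\<And>p. p \<in> A \<Longrightarrow> \<not> D p (h p)"
      by metis
    obtain p where "p \<in> A" "\<forall>z<Suc (Max (h ` A)). D p z"
      using R by blast
    then show False
      using h assms by (metis Max_ge finite_imageI imageI le_imp_less_Suc)
  qed
qed blast

lemma Sigma0_2_fn_bound:
  fixes f :: "nat \<Rightarrow> nat"
  assumes "Sigma0 2 2 (\<lambda>xs. f (xs ! 0) = xs ! 1)"
  obtains g where "Delta0_fn 2 g" "strict_mono g" "\<And>i x. i \<le> Suc x \<Longrightarrow> f i < g x"
proof -
  obtain C where C: "recursive_rel 4 C"
    and C_iff: "\<And>xs. length xs = 2 \<Longrightarrow> f (xs ! 0) = xs ! 1 \<longleftrightarrow> (\<exists>y. \<forall>z. C (z # y # xs))"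
    using assms unfolding Sigma0_2_iff by (auto simp: eval_nat_numeral)
  have f_eq: "f i = w \<longleftrightarrow> (\<exists>y. \<forall>z. C [z, y, i, w])" for i w
    using C_iff[of "[i, w]"] by simp
  \<comment> \<open>The shift by \<open>x\<close> in the bound \<open>v - x\<close> makes
    \<open>g\<close> strictly increasing.\<close>
  define P where "P x v \<longleftrightarrow> (\<forall>i<Suc (Suc x). \<exists>w<v - x. \<exists>y<v - x. \<forall>z. C [z, y, i, w])" for x v
  define Q where
    "Q Z x v \<longleftrightarrow> (\<forall>i<Suc (Suc x). \<exists>w<v - x. \<exists>y<v - x. \<forall>z<Z. C [z, y, i, w])" for Z x v
  define g where "g x = (LEAST v. P x v)" for x

  have P_iff: "P x v \<longleftrightarrow> (\<forall>Z. Q Z x v)" for x v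
  proof -
    have *: "(\<exists>w<a. \<exists>y<a. \<forall>z. C [z, y, i, w]) \<longleftrightarrow> (\<forall>Z. \<exists>w<a. \<exists>y<a. \<forall>z<Z. C [z, y, i, w])"
      for a i :: nat
    proof -
      \<comment> \<open>The pigeonhole lemma treats a single finite quantifier, so \<open>w\<close>
        and \<open>y\<close> are packed into a pair.\<close>
      have "(\<exists>p\<in>{..<a} \<times> {..<a}. R p) \<longleftrightarrow> (\<exists>w<a. \<exists>y<a. R (w, y))" for R :: "nat \<times> nat \<Rightarrow> bool"
        by auto
      then show ?thesis
        using bex_all_iff_all_bex_less[of "{..<a} \<times> {..<a}" "\<lambda>p z. C [z, snd p, i, fst p]"]
        by (simp only: finite_cartesian_product finite_lessThan fst_conv snd_conv)
    qed
    show ?thesis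
      unfolding P_def Q_def * by blast
  qed
  have mono: "P x v \<Longrightarrow> v \<le> v' \<Longrightarrow> P x v'" for x v v'
    unfolding P_def by (meson diff_le_mono less_le_trans)
  \<comment> \<open>At \<open>v = 0\<close> no \<open>w\<close> is available. Hence
    \<open>g x\<close> is positive and \<open>g x - 1\<close> is a true predecessor.\<close>
  have not_P_0: "\<not> P x 0" for x
    by (auto simp: P_def)
  have "\<exists>v. P x v" for x
  proof -
    have "\<forall>i. \<exists>y. \<forall>z. C [z, y, i, f i]"
      using f_eq by blast
    from choice[OF this] obtain h where h: "\<forall>i z. C [z, h i, i, f i]"
      by blast
    \<comment> \<open>This \<open>a\<close> exceeds all the values \<open>f i\<close> and witnesses
      \<open>h i\<close> concerned, so \<open>v = a + x\<close> meets the condition.\<close>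
    define a where "a = Suc (\<Sum>i<Suc (Suc x). h i + f i)"
    have "h i + f i < a" if "i < Suc (Suc x)" for i
      using member_le_sum[of i "{..<Suc (Suc x)}" "\<lambda>i. h i + f i"] that by (simp add: a_def)
    then have "f i < a \<and> h i < a" if "i < Suc (Suc x)" for i
      using that by fastforce
    then have "P x (a + x)"
      unfolding P_def add_diff_cancel_right' using h by blast
    then show ?thesis ..
  qed
  then have P_g: "P x (g x)" for x
    unfolding g_def by (rule LeastI_ex)
  have g_le: "P x v \<Longrightarrow> g x \<le> v" for x v
    unfolding g_def by (rule Least_le)
  have g_pos: "g x > 0" for x
    using P_g not_P_0 by (metis gr0I)

  have "g x < g (Suc x)" for x
  proof -
    \<comment> \<open>Lowering both arguments by one preserves the difference \<open>v - x\<close>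
      and only shrinks the range of \<open>i\<close>.\<close>
    have "P x (g (Suc x) - 1)"
      using P_g[of "Suc x"] unfolding P_def by simp
    then show ?thesis
      using g_le[of x] g_pos[of "Suc x"] by fastforce
  qed
  then have "strict_mono g"
    by (simp add: strict_mono_Suc_iff)
  moreover have "f i < g x" if i: "i \<le> Suc x" for i x
  proof -
    obtain w where "w < g x - x" "\<exists>y. \<forall>z. C [z, y, i, w]"
      using P_g[of x] i unfolding P_def by (meson le_imp_less_Suc)
    then show ?thesis
      \<comment> \<open>A \<open>w\<close> with such a \<open>y\<close> is \<open>f i\<close>
        itself.\<close>
      using f_eq[of i w] by simp
  qed
  moreover have "Delta0_fn 2 g"
    unfolding Delta0_fn_def
  proof (rule Delta0_2I)
    \<comment> \<open>The quantifiers are added from the inside out; the seven variables are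
      \<open>z, y, w, i, Z, x, v\<close>, so \<open>i\<close> and \<open>w\<close> are swapped for
      \<open>C\<close>.\<close>
    have "recursive_rel 7 (\<lambda>ys. C (map (\<lambda>g. g ys) (map (\<lambda>i ys. ys ! i) [0, 1, 3, 2])))"
      by (rule recursive_rel_comp) (use C recursive_on_nth in \<open>auto simp: eval_nat_numeral\<close>)
    then have "recursive_rel 7 (\<lambda>ys. C [ys ! 0, ys ! 1, ys ! 3, ys ! 2])"
      by simp
    then have "recursive_rel 6 (\<lambda>ys. \<forall>z<ys ! 3. C [z, ys ! 0, ys ! 2, ys ! 1])"
      using recursive_rel_ball_less[OF recursive_on_nth[of 3 6],
          of "\<lambda>ys. C [ys ! 0, ys ! 1, ys ! 3, ys ! 2]"]
      by (simp add: eval_nat_numeral)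
    then have "recursive_rel 5 (\<lambda>ys. \<exists>y<ys ! 4 - ys ! 3. \<forall>z<ys ! 2. C [z, y, ys ! 1, ys ! 0])"
      using recursive_rel_bex_less[OF recursive_on_diff[OF recursive_on_nth[of 4 5]
            recursive_on_nth[of 3 5]],
          of "\<lambda>ys. \<forall>z<ys ! 3. C [z, ys ! 0, ys ! 2, ys ! 1]"]
      by (simp add: eval_nat_numeral)
    then have "recursive_rel 4 (\<lambda>ys. \<exists>w<ys ! 3 - ys ! 2.
        \<exists>y<ys ! 3 - ys ! 2. \<forall>z<ys ! 1. C [z, y, ys ! 0, w])"
      using recursive_rel_bex_less[OF recursive_on_diff[OF recursive_on_nth[of 3 4]
            recursive_on_nth[of 2 4]],
          of "\<lambda>ys. \<exists>y<ys ! 4 - ys ! 3. \<forall>z<ys ! 2. C [z, y, ys ! 1, ys ! 0]"]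
      by (simp add: eval_nat_numeral)
    then have Q: "recursive_rel 3 (\<lambda>ys. Q (ys ! 0) (ys ! 1) (ys ! 2))"
      using recursive_rel_ball_less[OF recursive_on_Suc[OF recursive_on_Suc[OF recursive_on_nth[of 1 3]]],
          of "\<lambda>ys. \<exists>w<ys ! 3 - ys ! 2. \<exists>y<ys ! 3 - ys ! 2. \<forall>z<ys ! 1. C [z, y, ys ! 0, w]"]
      by (simp add: eval_nat_numeral Q_def)
    then show "recursive_rel (Suc 2) (\<lambda>ys. Q (ys ! 0) (ys ! 1) (ys ! 2))"
      by simp
    let ?gs = "[\<lambda>ys. ys ! 0, \<lambda>ys. ys ! 1, \<lambda>ys. ys ! 2 - 1] :: (nat list \<Rightarrow> nat) list"
    have "recursive_on 3 h" if "h \<in> set ?gs" for h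
      using that recursive_on_nth recursive_on_pred[OF recursive_on_nth[of 2 3]] by auto
    then have "recursive_rel 3 (\<lambda>ys. Q (ys ! 0) (ys ! 1) (ys ! 2 - 1))"
      using recursive_rel_comp[of ?gs "\<lambda>ys. Q (ys ! 0) (ys ! 1) (ys ! 2)" 3] Q
      by (simp add: eval_nat_numeral)
    from recursive_rel_not[OF this]
    show "recursive_rel (Suc 2) (\<lambda>ys. \<not> Q (ys ! 0) (ys ! 1) (ys ! 2 - 1))"
      by simp
    have "g x = v \<longleftrightarrow> P x v \<and> \<not> P x (v - 1)" for x v
    proof
      assume "g x = v"
      then show "P x v \<and> \<not> P x (v - 1)"
        using P_g[of x] g_le[of x "v - 1"] g_pos[of x] by auto
    next
      assume *: "P x v \<and> \<not> P x (v - 1)"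
      then have "\<not> g x \<le> v - 1"
        using mono P_g by blast
      then show "g x = v"
        using g_le[of x v] * by simp
    qed
    then show "g (xs ! 0) = xs ! 1 \<longleftrightarrow>
        (\<forall>z. Q ((z # xs) ! 0) ((z # xs) ! 1) ((z # xs) ! 2)) \<and>
        (\<exists>z. \<not> Q ((z # xs) ! 0) ((z # xs) ! 1) ((z # xs) ! 2 - 1))" for xs
      by (simp add: P_iff eval_nat_numeral)
  qed
  ultimately show thesis
    using that by blast
qed

section \<open>Gaps in transitive sets\<close>

lemma g_transitive_large_gap:
  assumes inf: "infinite H" and trans: "g_transitive g H"
  obtains n where "g (enumerate H n) \<le> enumerate H (Suc n)"
proof -
  let ?e = "enumerate H"
  \<comment> \<open>Index 0 is put in explicitly, since \<open>g (?e 0) \<le> ?e 0\<close> is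
    possible and \<open>Max\<close> needs a nonempty set.\<close>
  let ?S = "{n. n = 0 \<or> ?e n < g (?e 0)}"
  have step: "?e m < ?e n" if "m < n" for m n
    using enumerate_mono[OF that inf] .
  have mem: "?e n \<in> H" for n
    using enumerate_in_set[OF inf] .
  have "finite ?S"
  proof (rule finite_subset)
    show "?S \<subseteq> {..g (?e 0)}"
      using le_enumerate[OF inf] by (auto intro: order.strict_implies_order order.strict_trans1)
  qed simp
  define n where "n = Max ?S"
  have n: "n \<in> ?S"
    unfolding n_def using \<open>finite ?S\<close> by (intro Max_in) auto
  have "Suc n \<notin> ?S"
    using Max_ge[OF \<open>finite ?S\<close>, of "Suc n"] unfolding n_def[symmetric] by auto
  then have large: "g (?e 0) \<le> ?e (Suc n)"
    by simp
  have "g (?e n) \<le> ?e (Suc n)"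
  proof (cases "n = 0")
    case True
    then show ?thesis
      using large by simp
  next
    case False
    then have "g_small g (?e 0) (?e n)" "\<not> g_small g (?e 0) (?e (Suc n))"
      using n large by (auto simp: g_small_def g_large_def)
    then have "\<not> g_small g (?e n) (?e (Suc n))"
      using trans mem step False unfolding g_transitive_def by (metis lessI neq0_conv)
    then show ?thesis
      by (simp add: g_small_def g_large_def)
  qed
  then show thesis
    by (rule that)
qed

theorem theorem5p16:
  fixes f :: "nat \<Rightarrow> nat"
  assumes "Delta0_fn 2 f"
  shows "\<exists>g :: nat \<Rightarrow> nat. Delta0_fn 2 g \<and> strict_mono g \<and>
    (\<forall>H :: nat set. infinite H \<and> g_transitive g H \<longrightarrow> \<not> dominates f (principal_fn H))"
proof -
  obtain g where g: "Delta0_fn 2 g" "strict_mono g" "\<And>i x. i \<le> Suc x \<Longrightarrow> f i < g x"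
    using assms Sigma0_2_fn_bound unfolding Delta0_fn_def Delta0_def by blast
  have "\<not> dominates f (principal_fn H)" if inf: "infinite H" and trans: "g_transitive g H" for H
  proof -
    obtain n where "g (enumerate H n) \<le> enumerate H (Suc n)"
      using g_transitive_large_gap[OF inf trans] .
    \<comment> \<open>Since \<open>n \<le> enumerate H n\<close>, the index \<open>Suc n\<close> is
      at most one above the argument of \<open>g\<close>, which the bound on \<open>f\<close>
      covers.\<close>
    moreover have "f (Suc n) < g (enumerate H n)"
      using le_enumerate[OF inf, of n] by (intro g(3)) simp
    ultimately show ?thesis
      unfolding dominates_def principal_fn_def by (meson leD order.strict_trans2)
  qed
  then show ?thesis
    using g by blast
qed

end
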